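(* There are a constant-free log--exp term $F$ (in one variable) and an integer $B\ge4$ such that the set $$\left\{s\in\mathbb{N}: s\ge B,\ \text{and for some } t\ge1,\ F^j(s)\ge B \text{ for } 0\le j<t \text{ and } F^t(s)<B\right\}$$ is undecidable.
   Context: $\mathbb{N}=\{0,1,2,\ldots\}$. $F^j$ denotes the $j$-fold iterate of the partial function denoted by $F$, with $F^0(s)=s$; the conditions $F^j(s)\ge B$ and $F^t(s)<B$ include that the values are defined and real. Principal values: for $z\in\mathbb{C}\setminus\{0\}$, $\operatorname{Log} z=\log|z|+i\operatorname{Arg} z$ with $\operatorname{Arg} z\in(-\pi,\pi]$. For $x\neq 0$, $x^y:=e^{y\operatorname{Log}x}$; for $a,b\ne0$ with $b\neq1$, $\log_b a:=\operatorname{Log}a/\operatorname{Log}b$. A log--exp term is a finite term built from the two binary operations $x^y$ and $\log_b a$, along with one or more variables and/or constants. It denotes a partial function: an input is outside its domain if any subterm asks for one of the excluded logarithms or bases. Constant-free means that only variables occur as leaves. *)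

theory Defs
  imports "HOL-Analysis.Complex_Transcendental"
begin

section \<open>Log-exp terms\<close>

text \<open>
  In \<open>Log b a\<close> the base comes first, as in $\log_b a$.
\<close>

datatype 'v log_exp_term =
    Var 'v
  | Const complex
  | Pow "'v log_exp_term" "'v log_exp_term"
  | Log "'v log_exp_term" "'v log_exp_term"

primrec constant_free :: "'v log_exp_term \<Rightarrow> bool" where
  "constant_free (Var v) = True"
| "constant_free (Const c) = False"
| "constant_free (Pow p q) = (constant_free p \<and> constant_free q)"
| "constant_free (Log p q) = (constant_free p \<and> constant_free q)"

text \<open>
  The library's \<open>Ln\<close> is the principal logarithm, with imaginary part in $(-\pi,\pi]$, and
  \<open>x powr y = exp (y * Ln x)\<close> for \<open>x \<noteq> 0\<close>.  The library's totalised values of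
  \<open>0 powr y\<close>, \<open>Ln 0\<close> and division by \<open>Ln 1\<close> are never used.
\<close>

definition pow_partial :: "complex \<Rightarrow> complex \<Rightarrow> complex option" where
  "pow_partial x y = (if x \<noteq> 0 then Some (x powr y) else None)"

definition log_partial :: "complex \<Rightarrow> complex \<Rightarrow> complex option" where
  "log_partial b a =
    (if a \<noteq> 0 \<and> b \<noteq> 0 \<and> b \<noteq> 1 then Some (Ln a / Ln b) else None)"

primrec denote :: "'v log_exp_term \<Rightarrow> ('v \<Rightarrow> complex) \<Rightarrow> complex option" where
  "denote (Var v) \<rho> = Some (\<rho> v)"
| "denote (Const c) \<rho> = Some c"
| "denote (Pow p q) \<rho> =
    Option.bind (denote p \<rho>) (\<lambda>x. Option.bind (denote q \<rho>) (\<lambda>y. pow_partial x y))"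
| "denote (Log p q) \<rho> =
    Option.bind (denote p \<rho>) (\<lambda>b. Option.bind (denote q \<rho>) (\<lambda>a. log_partial b a))"

text \<open>Terms in one variable are those of type \<open>unit log_exp_term\<close>.\<close>

definition denote1 :: "unit log_exp_term \<Rightarrow> complex \<Rightarrow> complex option" where
  "denote1 F z = denote F (\<lambda>_. z)"

primrec iterate_partial :: "('a \<Rightarrow> 'a option) \<Rightarrow> nat \<Rightarrow> 'a \<Rightarrow> 'a option" where
  "iterate_partial f 0 s = Some s"
| "iterate_partial f (Suc j) s = Option.bind (iterate_partial f j s) f"


section \<open>Decidable sets of natural numbers\<close>

text \<open>
  Kleene's partial recursive functions.  \<open>Zero\<close> and \<open>Proj i\<close> may be used at any arity
  (greater than \<open>i\<close> for \<open>Proj i\<close>); primitive recursion and minimisation act on the first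
  argument.  \<open>rec_eval f xs y\<close> says that \<open>f\<close> is defined at \<open>xs\<close> with value \<open>y\<close>.
\<close>

datatype recf =
    Zero
  | Succ
  | Proj nat
  | Comp recf "recf list"
  | PrimRec recf recf
  | Mu recf

inductive rec_eval :: "recf \<Rightarrow> nat list \<Rightarrow> nat \<Rightarrow> bool" where
  zero: "rec_eval Zero xs 0"
| succ: "rec_eval Succ [x] (Suc x)"
| proj: "i < length xs \<Longrightarrow> rec_eval (Proj i) xs (xs ! i)"
| comp: "list_all2 (\<lambda>g y. rec_eval g xs y) gs ys \<Longrightarrow> rec_eval f ys z \<Longrightarrow>
    rec_eval (Comp f gs) xs z"
| primrec_0: "rec_eval g xs y \<Longrightarrow> rec_eval (PrimRec g h) (0 # xs) y"
| primrec_Suc: "rec_eval (PrimRec g h) (n # xs) y \<Longrightarrow> rec_eval h (n # y # xs) z \<Longrightarrow>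
    rec_eval (PrimRec g h) (Suc n # xs) z"
| mu: "rec_eval f (n # xs) 0 \<Longrightarrow> \<forall>m<n. \<exists>k. rec_eval f (m # xs) (Suc k) \<Longrightarrow>
    rec_eval (Mu f) xs n"

inductive_cases rec_eval_ZeroE: "rec_eval Zero xs y"
inductive_cases rec_eval_SuccE: "rec_eval Succ xs y"
inductive_cases rec_eval_ProjE: "rec_eval (Proj i) xs y"
inductive_cases rec_eval_CompE: "rec_eval (Comp f gs) xs y"
inductive_cases rec_eval_PrimRec_0E: "rec_eval (PrimRec g h) (0 # xs) y"
inductive_cases rec_eval_PrimRec_SucE: "rec_eval (PrimRec g h) (Suc n # xs) y"
inductive_cases rec_eval_MuE: "rec_eval (Mu f) xs y"

lemma rec_eval_functional: "rec_eval f xs y \<Longrightarrow> rec_eval f xs y' \<Longrightarrow> y = y'"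
proof (induction arbitrary: y' rule: rec_eval.induct)
  case (zero xs)
  then show ?case by (rule rec_eval_ZeroE) simp
next
  case (succ x)
  then show ?case by (rule rec_eval_SuccE) simp
next
  case (proj i xs)
  from proj.prems show ?case by (rule rec_eval_ProjE) simp
next
  case (comp xs gs ys f z)
  from comp.prems obtain ys' where ys': "list_all2 (\<lambda>g y. rec_eval g xs y) gs ys'"
    and z: "rec_eval f ys' y'" by (rule rec_eval_CompE)
  have "ys = ys'"
    using comp.IH(1) ys' by (auto simp: list_all2_conv_all_nth intro!: nth_equalityI)
  with z comp.IH(2) show ?case by simp
next
  case (primrec_0 g xs y h)
  from primrec_0.prems have "rec_eval g xs y'" by (rule rec_eval_PrimRec_0E)
  then show ?case by (rule primrec_0.IH)
next
  case (primrec_Suc g h n xs y z)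
  from primrec_Suc.prems obtain w where w: "rec_eval (PrimRec g h) (n # xs) w"
    and y': "rec_eval h (n # w # xs) y'" by (rule rec_eval_PrimRec_SucE)
  from primrec_Suc.IH(1)[OF w] y' have "rec_eval h (n # y # xs) y'" by simp
  then show ?case by (rule primrec_Suc.IH(2))
next
  case (mu f n xs)
  from mu.prems have 0: "rec_eval f (y' # xs) 0"
    and less: "\<forall>m<y'. \<exists>k. rec_eval f (m # xs) (Suc k)" by (auto elim!: rec_eval_MuE)
  have "\<not> n < y'" using less mu.IH(1) by (metis nat.distinct(1))
  moreover have "\<not> y' < n" using 0 mu.IH(2) by (metis nat.distinct(1))
  ultimately show ?case by simp
qed

definition decidable :: "nat set \<Rightarrow> bool" where
  "decidable A \<longleftrightarrow> (\<exists>f. \<forall>n. rec_eval f [n] (if n \<in> A then 1 else 0))"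

end

theory Submission imports Defs begin

text \<open>
  The term \<open>F\<close> performs one step of an interpreter for all partial recursive functions, acting on
  natural numbers that code the interpreter's configurations; an empty stack is sent to \<open>0\<close>, and
  every configuration is at least \<open>4\<close>.  So the iteration drops below \<open>4\<close> exactly when the
  interpreter halts.

  Why a log-exp term can do this.  For a real \<open>x > 1\<close> one has \<open>log\<^sub>x x = 1\<close>,
  \<open>log\<^sub>x ((x\<^sup>a)\<^sup>b) = a b\<close>, \<open>log\<^sub>x (x\<^sup>a x\<^sup>b) = a + b\<close>, and the base \<open>x\<^sup>b\<close> gives \<open>a / b\<close>; hence all field
  operations on real values are available, without constants.  The branch cut supplies the one
  discontinuous function needed: \<open>log\<close> to the base \<open>-1\<close> of \<open>(-1)\<^sup>s\<close> is \<open>s\<close> reduced modulo \<open>2\<close> to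
  \<open>(-1, 1]\<close>, from which the floor function follows.  With floor and square root come
  equality tests, definition by cases, truncated subtraction, and a pairing function
  together with its projections (\<open>representable_if\<close>, \<open>representable_left\<close>, \<open>representable_right\<close>).
  A step of a stack machine is a definition by cases from these (\<open>representable_machine_step\<close>).

  Why the set is undecidable.  The machine completes every evaluation that is defined
  (\<open>rec_eval_reaches\<close>).  If \<open>f\<close> decided the set, let \<open>d\<close> search on input \<open>n\<close> for a zero of the
  constant function \<open>f (start n)\<close>, where \<open>start n\<close> is the configuration running the program coded by
  \<open>n\<close> on the input \<open>n\<close>.  On its own code, \<open>d\<close> stops if \<open>f\<close> predicts that the machine does not, and
  otherwise the machine demonstrably cycles through the unsuccessful search forever
  (\<open>search_diverges\<close>).  Either way the prediction is wrong.
\<close>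

section \<open>Real functions given by constant-free terms\<close>

text \<open>
  The argument ranges over natural numbers from \<open>4\<close> on, so it may serve as the base of
  a logarithm.
\<close>

definition real_representable :: "(nat \<Rightarrow> real) \<Rightarrow> bool" where
  "real_representable f \<longleftrightarrow> (\<exists>t :: unit log_exp_term. constant_free t \<and>
     (\<forall>n\<ge>4. denote1 t (of_nat n) = Some (complex_of_real (f n))))"

lemma real_representable_cong:
  assumes "real_representable g" and "\<And>n. n \<ge> 4 \<Longrightarrow> f n = g n"
  shows "real_representable f"
  using assms unfolding real_representable_def by auto

lemma real_representable_arg: "real_representable real"
  unfolding real_representable_def denote1_def by (intro exI[of _ "Var ()"]) simp

lemma real_representable_powr:
  assumes "real_representable f" "real_representable g" and pos: "\<And>n. n \<ge> 4 \<Longrightarrow> f n > 0"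
  shows "real_representable (\<lambda>n. f n powr g n)"
proof -
  obtain s t where "constant_free s" "constant_free t"
    and "\<forall>n\<ge>4. denote1 s (of_nat n) = Some (complex_of_real (f n))"
    and "\<forall>n\<ge>4. denote1 t (of_nat n) = Some (complex_of_real (g n))"
    using assms(1,2) unfolding real_representable_def by blast
  moreover have "pow_partial (complex_of_real (f n)) (complex_of_real (g n))
      = Some (complex_of_real (f n powr g n))" if "n \<ge> 4" for n
    using pos[OF that] by (auto simp: pow_partial_def powr_of_real)
  ultimately show ?thesis
    unfolding real_representable_def denote1_def by (intro exI[of _ "Pow s t"]) auto
qed

lemma real_representable_log:
  assumes "real_representable f" "real_representable g"
    and pos: "\<And>n. n \<ge> 4 \<Longrightarrow> f n > 0" "\<And>n. n \<ge> 4 \<Longrightarrow> f n \<noteq> 1" "\<And>n. n \<ge> 4 \<Longrightarrow> g n > 0"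
  shows "real_representable (\<lambda>n. log (f n) (g n))"
proof -
  obtain s t where st: "constant_free s" "constant_free t"
    "\<forall>n\<ge>4. denote1 s (of_nat n) = Some (complex_of_real (f n))"
    "\<forall>n\<ge>4. denote1 t (of_nat n) = Some (complex_of_real (g n))"
    using assms(1,2) unfolding real_representable_def by blast
  have "log_partial (complex_of_real (f n)) (complex_of_real (g n))
      = Some (complex_of_real (log (f n) (g n)))" if "n \<ge> 4" for n
    using pos(1)[OF that] pos(2)[OF that] pos(3)[OF that]
    by (auto simp: log_partial_def log_def Ln_of_real)
  then show ?thesis
    using st unfolding real_representable_def denote1_def
    by (intro exI[of _ "Log s t"]) auto
qed

lemma real_representable_one: "real_representable (\<lambda>_. 1)"
  by (rule real_representable_cong[OF
        real_representable_log[OF real_representable_arg real_representable_arg]]) auto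

lemma real_representable_mult:
  assumes "real_representable f" "real_representable g"
  shows "real_representable (\<lambda>n. f n * g n)"
proof -
  have "real_representable (\<lambda>n. log (real n) ((real n powr f n) powr g n))"
    using assms
    by (intro real_representable_log real_representable_powr real_representable_arg) auto
  then show ?thesis
    by (rule real_representable_cong) (simp add: powr_powr)
qed

lemma real_representable_add:
  assumes "real_representable f" "real_representable g"
  shows "real_representable (\<lambda>n. f n + g n)"
proof -
  have "real_representable (\<lambda>n. log (real n) ((real n powr f n) * (real n powr g n)))"
    using assms by (intro real_representable_log real_representable_mult
        real_representable_powr real_representable_arg) auto
  then show ?thesis
    by (rule real_representable_cong) (simp flip: powr_add)
qed

lemma real_representable_divide:
  assumes "real_representable f" "real_representable g" and "\<And>n. n \<ge> 4 \<Longrightarrow> g n \<noteq> 0"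
  shows "real_representable (\<lambda>n. f n / g n)"
proof -
  have "real n powr g n \<noteq> 1" if "n \<ge> 4" for n
    using assms(3)[OF that] that by (simp add: powr_def)
  then have "real_representable (\<lambda>n. log (real n powr g n) (real n powr f n))"
    using assms by (intro real_representable_log
        real_representable_powr real_representable_arg) auto
  then show ?thesis
    by (rule real_representable_cong) (simp add: log_def ln_powr)
qed

lemma real_representable_minus_one: "real_representable (\<lambda>_. - 1)"
proof -
  have "real_representable (\<lambda>n. log (real n) (1 / real n))"
    by (intro real_representable_log real_representable_divide real_representable_one
        real_representable_arg) auto
  then show ?thesis
    by (rule real_representable_cong) (simp add: log_divide)
qed

lemma real_representable_diff:
  assumes "real_representable f" "real_representable g"
  shows "real_representable (\<lambda>n. f n - g n)"
  using real_representable_add[OF assms(1)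
      real_representable_mult[OF real_representable_minus_one assms(2)]] by simp

lemma real_representable_of_nat: "real_representable (\<lambda>_. real k)"
proof (induction k)
  case 0
  show ?case
    using real_representable_diff[OF real_representable_one real_representable_one] by simp
next
  case (Suc k)
  show ?case
    using real_representable_add[OF real_representable_one Suc] by simp
qed

text \<open>
  The branch cut enters here.  As \<open>(-1)\<close> to the power \<open>1 - 2 y\<close> has period \<open>1\<close> in \<open>y\<close>, and
  \<open>1 - 2 u\<close> runs through \<open>(-1, 1]\<close> for \<open>0 \<le> u < 1\<close>, the principal logarithm recovers
  \<open>1 - 2 u\<close> with \<open>u\<close> the fractional part of \<open>y\<close>.
\<close>

lemma log_minus_one_sawtooth:
  "log_partial (- 1) ((- 1) powr complex_of_real (1 - 2 * y))
    = Some (complex_of_real (1 - 2 * frac y))"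
proof -
  let ?z = "\<i> * complex_of_real (pi * (1 - 2 * y))"
  let ?w = "\<i> * complex_of_real (pi * (1 - 2 * frac y))"
  have eq: "?z = ?w + complex_of_real (real_of_int (2 * - \<lfloor>y\<rfloor>) * pi) * \<i>"
    by (simp add: frac_def algebra_simps)
  have "(- 1) powr complex_of_real (1 - 2 * y) = exp ?z"
    by (simp add: powr_def algebra_simps)
  also have "\<dots> = exp ?w"
    unfolding exp_eq using eq by blast
  finally have power: "(- 1) powr complex_of_real (1 - 2 * y) = exp ?w" .
  have lo: "- pi < pi * (1 - 2 * frac y)"
    using mult_strict_left_mono[of "-1" "1 - 2 * frac y" pi] frac_lt_1[of y] by simp
  have hi: "pi * (1 - 2 * frac y) \<le> pi"
    using mult_left_mono[of "1 - 2 * frac y" 1 pi] frac_ge_0[of y] by simp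
  have "Ln (exp ?w) = ?w"
    using lo hi by (intro Ln_exp) simp_all
  then show ?thesis
    unfolding log_partial_def power by simp
qed

lemma real_representable_floor:
  assumes "real_representable f"
  shows "real_representable (\<lambda>n. of_int \<lfloor>f n\<rfloor>)"
proof -
  have const2: "real_representable (\<lambda>_. 2)"
    using real_representable_of_nat[of 2] by simp
  obtain m where m: "constant_free m" "\<forall>n\<ge>4. denote1 m (of_nat n) = Some (- 1)"
    using real_representable_minus_one unfolding real_representable_def by auto
  have affine: "real_representable (\<lambda>n. 1 - 2 * f n)"
    by (intro real_representable_diff real_representable_mult const2 real_representable_one assms)
  then obtain t where t: "constant_free t"
    "\<forall>n\<ge>4. denote1 t (of_nat n) = Some (complex_of_real (1 - 2 * f n))"
    unfolding real_representable_def by blast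
  have "denote1 (Log m (Pow m t)) (of_nat n) = Some (complex_of_real (1 - 2 * frac (f n)))"
    if "n \<ge> 4" for n
    using m(2) t(2) that log_minus_one_sawtooth[of "f n"]
    by (simp add: denote1_def pow_partial_def del: of_real_diff)
  with m(1) t(1) have "real_representable (\<lambda>n. 1 - 2 * frac (f n))"
    unfolding real_representable_def by (intro exI[of _ "Log m (Pow m t)"]) auto
  then have "real_representable (\<lambda>n. ((1 - 2 * frac (f n)) - (1 - 2 * f n)) / 2)"
    using affine by (intro real_representable_divide real_representable_diff[where f =
        "\<lambda>n. 1 - 2 * frac (f n)"] const2) simp_all
  then show ?thesis
    by (rule real_representable_cong) (simp add: frac_def)
qed

section \<open>Representable functions on the natural numbers\<close>

definition representable :: "(nat \<Rightarrow> nat) \<Rightarrow> bool" where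
  "representable f \<longleftrightarrow> real_representable (\<lambda>n. real (f n))"

lemma representable_arg: "representable (\<lambda>n. n)"
  unfolding representable_def by (rule real_representable_arg)

lemma representable_const: "representable (\<lambda>_. k)"
  unfolding representable_def by (rule real_representable_of_nat)

lemma representable_add:
  "representable f \<Longrightarrow> representable g \<Longrightarrow> representable (\<lambda>n. f n + g n)"
  unfolding representable_def by (simp add: real_representable_add)

lemma representable_Suc: "representable f \<Longrightarrow> representable (\<lambda>n. Suc (f n))"
  using representable_add[OF _ representable_const[of 1]] by simp

lemma representable_mult:
  "representable f \<Longrightarrow> representable g \<Longrightarrow> representable (\<lambda>n. f n * g n)"
  unfolding representable_def by (simp add: real_representable_mult)

lemma representable_div_Suc:
  assumes "representable f" "representable g"
  shows "representable (\<lambda>n. f n div Suc (g n))"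
proof -
  have "real_representable (\<lambda>n. of_int \<lfloor>real (f n) / real (Suc (g n))\<rfloor>)"
    using assms representable_Suc[OF assms(2)] unfolding representable_def
    by (intro real_representable_floor real_representable_divide) auto
  then show ?thesis
    unfolding representable_def
    by (rule real_representable_cong) (simp only: floor_divide_of_nat_eq of_int_of_nat_eq)
qed

text \<open>The quotient \<open>1 div Suc m\<close> is the indicator of \<open>m = 0\<close>.\<close>

lemma representable_if_zero:
  assumes "representable f" "representable g" "representable h"
  shows "representable (\<lambda>n. if f n = 0 then g n else h n)"
proof -
  let ?c = "\<lambda>n. 1 div Suc (f n)"
  have c: "representable ?c"
    by (intro representable_div_Suc representable_const assms)
  have "representable (\<lambda>n. ?c n * g n + (1 div Suc (?c n)) * h n)"
    by (intro representable_add representable_mult representable_div_Suc representable_const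
        c assms)
  moreover have "(\<lambda>n. ?c n * g n + (1 div Suc (?c n)) * h n) =
      (\<lambda>n. if f n = 0 then g n else h n)"
    by (auto simp: fun_eq_iff)
  ultimately show ?thesis by simp
qed

lemma representable_diff:
  assumes "representable f" "representable g"
  shows "representable (\<lambda>n. f n - g n)"
proof -
  (* The quotient vanishes exactly if f n < g n, where truncation is needed. *)
  let ?q = "\<lambda>n. Suc (f n) div Suc (g n)"
  have q: "representable ?q"
    by (intro representable_div_Suc representable_Suc assms)
  have ind: "representable (\<lambda>n. if ?q n = 0 then 0 else 1)"
    by (intro representable_if_zero representable_const q)
  have "real_representable (\<lambda>n. real (if ?q n = 0 then 0 else 1) * (real (f n) - real (g n)))"
    using assms ind unfolding representable_def
    by (intro real_representable_mult real_representable_diff)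
  then show ?thesis
    unfolding representable_def
    by (rule real_representable_cong) (auto simp: div_eq_0_iff of_nat_diff)
qed

lemma representable_if:
  assumes "representable f" "representable g" "representable h"
  shows "representable (\<lambda>n. if f n = k then g n else h n)"
proof -
  have "representable (\<lambda>n. if (f n - k) + (k - f n) = 0 then g n else h n)"
    by (intro representable_if_zero representable_add representable_diff representable_const assms)
  moreover have "(f n - k) + (k - f n) = 0 \<longleftrightarrow> f n = k" for n
    by auto
  ultimately show ?thesis by simp
qed

section \<open>A representable pairing function\<close>

text \<open>
  The root of the square recovers \<open>a + b\<close>, and the excess over the square is \<open>a\<close>.  The summand
  \<open>2\<close> makes all pairs at least \<open>4\<close>: they differ from \<open>0\<close>, which serves as the empty list, and as
  configurations they stay above the threshold.
\<close>

definition pair :: "nat \<Rightarrow> nat \<Rightarrow> nat" where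
  "pair a b = (a + b + 2) * (a + b + 2) + a"

text \<open>
  The root is taken of \<open>Suc n\<close> since a power with base \<open>0\<close> is undefined; the excess of a pair over
  its square is small enough for this to make no difference.
\<close>

definition pair_root :: "nat \<Rightarrow> nat" where
  "pair_root n = nat \<lfloor>sqrt (real (Suc n))\<rfloor>"

definition left :: "nat \<Rightarrow> nat" where
  "left n = n - pair_root n * pair_root n"

definition right :: "nat \<Rightarrow> nat" where
  "right n = pair_root n - left n - 2"

lemma pair_root_pair: "pair_root (pair a b) = a + b + 2"
proof -
  let ?s = "a + b + 2"
  have "real ?s \<le> sqrt (real (Suc (pair a b)))"
    by (rule real_le_rsqrt) (simp add: pair_def power2_eq_square algebra_simps)
  moreover have "sqrt (real (Suc (pair a b))) < real ?s + 1"
  proof (rule real_less_lsqrt)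
    show "real (Suc (pair a b)) < (real ?s + 1)\<^sup>2"
      by (simp add: pair_def power2_eq_square algebra_simps)
  qed auto
  ultimately have "\<lfloor>sqrt (real (Suc (pair a b)))\<rfloor> = int ?s"
    by (intro floor_unique) simp_all
  then show ?thesis
    unfolding pair_root_def by simp
qed

lemma left_pair [simp]: "left (pair a b) = a"
  by (simp add: left_def pair_root_pair) (simp add: pair_def)

lemma right_pair [simp]: "right (pair a b) = b"
  by (simp add: right_def pair_root_pair)

lemma pair_ge_4: "4 \<le> pair a b"
  by (simp add: pair_def)

lemma pair_not_zero [simp]: "pair a b \<noteq> 0"
  using pair_ge_4[of a b] by simp

lemma representable_pair:
  "representable f \<Longrightarrow> representable g \<Longrightarrow> representable (\<lambda>n. pair (f n) (g n))"
  unfolding pair_def by (intro representable_add representable_mult representable_const)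

lemma representable_pair_root:
  assumes "representable f"
  shows "representable (\<lambda>n. pair_root (f n))"
proof -
  have "real_representable (\<lambda>n. of_int \<lfloor>real (Suc (f n)) powr (1 / real 2)\<rfloor>)"
    using representable_Suc[OF assms] unfolding representable_def
    by (intro real_representable_floor real_representable_powr real_representable_divide
        real_representable_one real_representable_of_nat) auto
  then show ?thesis
    unfolding representable_def pair_root_def
    by (rule real_representable_cong) (simp add: powr_half_sqrt)
qed

lemma representable_left: "representable f \<Longrightarrow> representable (\<lambda>n. left (f n))"
  unfolding left_def
  by (intro representable_diff representable_mult representable_pair_root)

lemma representable_right: "representable f \<Longrightarrow> representable (\<lambda>n. right (f n))"
  unfolding right_def
  by (intro representable_diff representable_pair_root representable_left representable_const)

section \<open>A stack machine evaluating recursive functions\<close>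

text \<open>
  A configuration \<open>pair k r\<close> consists of a stack \<open>k\<close> of frames and the value \<open>r\<close> returned
  last.  A frame is an instruction together with an argument list, and an instruction is a tag
  with two operands.  Tags \<open>0\<close> to \<open>5\<close> evaluate the six forms of functions; tags \<open>6\<close>, \<open>7\<close>
  and \<open>8\<close> resume a composition, a recursion and a minimisation with the value \<open>r\<close> of a
  subcomputation.
\<close>

definition instr :: "nat \<Rightarrow> nat \<Rightarrow> nat \<Rightarrow> nat" where
  "instr t a b = pair t (pair a b)"

definition push :: "nat \<Rightarrow> nat \<Rightarrow> nat \<Rightarrow> nat" where
  "push i xs k = pair (pair i xs) k"

definition list_code :: "nat list \<Rightarrow> nat" where
  "list_code xs = foldr pair xs 0"

lemma list_code_simps [simp]:
  "list_code [] = 0"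
  "list_code (x # xs) = pair x (list_code xs)"
  by (simp_all add: list_code_def)

text \<open>
  The second component of the first operand of tag \<open>3\<close> accumulates the values of the inner
  functions, and the second operand of tag \<open>5\<close> is the current candidate of the search; both
  start at \<open>0\<close>.  The inner functions are listed in reverse, so that prepending their values
  one by one to the accumulator yields them in the right order.
\<close>

primrec code :: "recf \<Rightarrow> nat" where
  "code Zero = instr 0 0 0"
| "code Succ = instr 1 0 0"
| "code (Proj i) = instr 2 i 0"
| "code (Comp f gs) = instr 3 (pair (code f) 0) (list_code (rev (map code gs)))"
| "code (PrimRec g h) = instr 4 (code g) (code h)"
| "code (Mu f) = instr 5 (code f) 0"

definition tag_of :: "nat \<Rightarrow> nat" where
  "tag_of s = left (left (left (left s)))"

definition op1_of :: "nat \<Rightarrow> nat" where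
  "op1_of s = left (right (left (left (left s))))"

definition op2_of :: "nat \<Rightarrow> nat" where
  "op2_of s = right (right (left (left (left s))))"

definition args_of :: "nat \<Rightarrow> nat" where
  "args_of s = right (left (left s))"

definition rest_of :: "nat \<Rightarrow> nat" where
  "rest_of s = right (left s)"

definition result_of :: "nat \<Rightarrow> nat" where
  "result_of s = right s"

lemmas accessor_defs = tag_of_def op1_of_def op2_of_def args_of_def rest_of_def result_of_def

lemma accessors [simp]:
  "tag_of (pair (push (instr t a b) xs k) r) = t"
  "op1_of (pair (push (instr t a b) xs k) r) = a"
  "op2_of (pair (push (instr t a b) xs k) r) = b"
  "args_of (pair (push (instr t a b) xs k) r) = xs"
  "rest_of (pair (push (instr t a b) xs k) r) = k"
  "result_of (pair (push (instr t a b) xs k) r) = r"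
  by (simp_all add: accessor_defs push_def instr_def)

lemma representable_accessors:
  "representable tag_of" "representable op1_of" "representable op2_of"
  "representable args_of" "representable rest_of" "representable result_of"
  unfolding accessor_defs
  by (intro representable_left representable_right representable_arg)+

definition machine_step :: "nat \<Rightarrow> nat" where
  "machine_step s =
    (if left s = 0 then 0
     else if tag_of s = 0 then pair (rest_of s) 0
     else if tag_of s = 1 then pair (rest_of s) (Suc (left (args_of s)))
     else if tag_of s = 2 then
       (if op1_of s = 0 then pair (rest_of s) (left (args_of s))
        else pair (push (instr 2 (op1_of s - 1) 0) (right (args_of s)) (rest_of s)) 0)
     else if tag_of s = 3 then
       (if op2_of s = 0
        then pair (push (left (op1_of s)) (right (op1_of s)) (rest_of s)) 0
        else pair (push (left (op2_of s)) (args_of s)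
               (push (instr 6 (op1_of s) (right (op2_of s))) (args_of s) (rest_of s))) 0)
     else if tag_of s = 4 then
       (if left (args_of s) = 0
        then pair (push (op1_of s) (right (args_of s)) (rest_of s)) 0
        else pair (push (instr 4 (op1_of s) (op2_of s))
                     (pair (left (args_of s) - 1) (right (args_of s)))
               (push (instr 7 (op2_of s) (left (args_of s) - 1)) (right (args_of s))
                 (rest_of s))) 0)
     else if tag_of s = 5 then
       pair (push (op1_of s) (pair (op2_of s) (args_of s))
         (push (instr 8 (op1_of s) (op2_of s)) (args_of s) (rest_of s))) 0
     else if tag_of s = 6 then
       pair (push (instr 3 (pair (left (op1_of s)) (pair (result_of s) (right (op1_of s))))
         (op2_of s)) (args_of s) (rest_of s)) 0
     else if tag_of s = 7 then
       pair (push (op1_of s) (pair (op2_of s) (pair (result_of s) (args_of s))) (rest_of s)) 0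
     else if result_of s = 0 then pair (rest_of s) (op2_of s)
     else pair (push (instr 5 (op1_of s) (Suc (op2_of s))) (args_of s) (rest_of s)) 0)"

lemma representable_machine_step: "representable machine_step"
  unfolding machine_step_def push_def instr_def
  by (intro representable_if representable_pair representable_left representable_right
      representable_diff representable_Suc representable_const representable_arg
      representable_accessors)

text \<open>
  Values below the threshold are made absorbing: then the machine is known to run forever as soon
  as it is at or above the threshold at arbitrarily late times.
\<close>

definition machine :: "nat \<Rightarrow> nat" where
  "machine s = (if s < 4 then 0 else machine_step s)"

lemma machine_push [simp]:
  "machine (pair (push (instr t a b) xs k) r) = machine_step (pair (push (instr t a b) xs k) r)"
  using pair_ge_4[of "push (instr t a b) xs k" r] by (simp add: machine_def)

lemma machine_empty: "machine (pair 0 r) = 0"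
  by (simp add: machine_def machine_step_def)

lemma push_not_empty [simp]: "push i xs k \<noteq> 0"
  by (simp add: push_def)

definition reaches :: "nat \<Rightarrow> nat \<Rightarrow> bool" where
  "reaches s s' \<longleftrightarrow> (\<exists>t. (machine ^^ t) s = s')"

lemma reaches_refl: "reaches s s"
  unfolding reaches_def by (intro exI[of _ 0]) simp

lemma reaches_trans:
  assumes "reaches s s'" "reaches s' s''"
  shows "reaches s s''"
proof -
  obtain t t' where "(machine ^^ t) s = s'" "(machine ^^ t') s' = s''"
    using assms unfolding reaches_def by blast
  then have "(machine ^^ (t' + t)) s = s''"
    by (simp add: funpow_add)
  then show ?thesis
    unfolding reaches_def by blast
qed

lemma reaches_next: "machine s = s' \<Longrightarrow> reaches s s'"
  unfolding reaches_def by (intro exI[of _ 1]) simp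

lemma reaches_step: "reaches (machine s) s' \<Longrightarrow> reaches s s'"
  by (rule reaches_trans[OF reaches_next[OF refl]])

definition evaluates :: "recf \<Rightarrow> nat list \<Rightarrow> nat \<Rightarrow> bool" where
  "evaluates f xs y \<longleftrightarrow>
    (\<forall>k r. reaches (pair (push (code f) (list_code xs) k) r) (pair k y))"

lemma evaluatesD:
  "evaluates f xs y \<Longrightarrow> reaches (pair (push (code f) (list_code xs) k) r) (pair k y)"
  unfolding evaluates_def by blast

lemma evaluates_Proj: "i < length xs \<Longrightarrow> evaluates (Proj i) xs (xs ! i)"
proof (induction xs arbitrary: i)
  case (Cons x xs)
  show ?case
  proof (cases i)
    case 0
    then show ?thesis
      unfolding evaluates_def
      by (auto intro!: reaches_next simp: machine_step_def)
  next
    case (Suc j)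
    with Cons have "evaluates (Proj j) xs (xs ! j)" by simp
    show ?thesis
      unfolding evaluates_def
    proof (intro allI)
      fix k r
      show "reaches (pair (push (code (Proj i)) (list_code (x # xs)) k) r)
          (pair k ((x # xs) ! i))"
        using evaluatesD[OF \<open>evaluates (Proj j) xs (xs ! j)\<close>, of k 0] Suc
        by (intro reaches_step[of "pair (push _ _ _) r"]) (simp add: machine_step_def)
    qed
  qed
qed simp

text \<open>
  The lists are those of a composition in reverse, in the order in which the machine treats them.
\<close>

lemma reaches_arguments:
  assumes "list_all2 (\<lambda>g y. evaluates g xs y) gs ys"
  shows "reaches
    (pair (push (instr 3 (pair c (list_code zs)) (list_code (map code gs))) (list_code xs) k) r)
    (pair (push c (list_code (rev ys @ zs)) k) 0)"
  using assms
proof (induction gs ys arbitrary: zs r rule: list_all2_induct)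
  case Nil
  show ?case
    by (rule reaches_next) (simp add: machine_step_def)
next
  case (Cons g gs y ys)
  let ?k = "push (instr 6 (pair c (list_code zs)) (list_code (map code gs))) (list_code xs) k"
  show ?case
  proof (rule reaches_step)
    have "reaches (pair (push (code g) (list_code xs) ?k) 0) (pair ?k y)"
      using Cons.hyps by (intro evaluatesD) simp
    also have "reaches (pair ?k y)
        (pair (push c (list_code (rev ys @ (y # zs))) k) 0)"
      using Cons.IH[of "y # zs" 0]
      by (intro reaches_step[of "pair ?k y"]) (simp add: machine_step_def)
    finally (reaches_trans) show "reaches (machine (pair (push (instr 3 (pair c (list_code zs))
          (list_code (map code (g # gs)))) (list_code xs) k) r))
        (pair (push c (list_code (rev (y # ys) @ zs)) k) 0)"
      by (simp add: machine_step_def)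
  qed
qed

text \<open>
  An unsuccessful candidate makes the machine move on to the next one.  That this takes time is
  what makes an endless search an endless computation.
\<close>

lemma search_round:
  assumes "evaluates f (m # xs) (Suc y)"
  shows "\<exists>t>0. (machine ^^ t) (pair (push (instr 5 (code f) m) (list_code xs) k) r)
    = pair (push (instr 5 (code f) (Suc m)) (list_code xs) k) 0"
proof -
  let ?k = "push (instr 8 (code f) m) (list_code xs) k"
  let ?s' = "pair (push (instr 5 (code f) (Suc m)) (list_code xs) k) 0"
  have "reaches (pair (push (code f) (list_code (m # xs)) ?k) 0) (pair ?k (Suc y))"
    using assms by (rule evaluatesD)
  moreover have "reaches (pair ?k (Suc y)) ?s'"
    by (rule reaches_next) (simp add: machine_step_def)
  ultimately have "reaches (machine (pair (push (instr 5 (code f) m) (list_code xs) k) r)) ?s'"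
    by (auto intro: reaches_trans simp: machine_step_def)
  then obtain t where
    "(machine ^^ t) (machine (pair (push (instr 5 (code f) m) (list_code xs) k) r)) = ?s'"
    unfolding reaches_def by blast
  then show ?thesis
    by (intro exI[of _ "Suc t"]) (simp add: funpow_swap1)
qed

lemma reaches_search:
  assumes "\<And>m. m < n \<Longrightarrow> \<exists>y. evaluates f (m # xs) (Suc y)"
  shows "\<exists>r'. reaches (pair (push (instr 5 (code f) 0) (list_code xs) k) r)
    (pair (push (instr 5 (code f) n) (list_code xs) k) r')"
  using assms
proof (induction n)
  case 0
  show ?case by (blast intro: reaches_refl)
next
  case (Suc n)
  then obtain r' where "reaches (pair (push (instr 5 (code f) 0) (list_code xs) k) r)
      (pair (push (instr 5 (code f) n) (list_code xs) k) r')"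
    by auto
  moreover obtain y where "evaluates f (n # xs) (Suc y)"
    using Suc.prems by blast
  from search_round[OF this, of k r'] have
    "reaches (pair (push (instr 5 (code f) n) (list_code xs) k) r')
      (pair (push (instr 5 (code f) (Suc n)) (list_code xs) k) 0)"
    unfolding reaches_def by blast
  ultimately show ?case
    by (blast intro: reaches_trans)
qed

text \<open>
  Completeness of the machine, by induction on the evaluation: each rule is matched by a
  few steps around the computations of its premises.
\<close>

lemma rec_eval_reaches: "rec_eval f xs y \<Longrightarrow> evaluates f xs y"
proof (induction rule: rec_eval.induct)
  case (zero xs)
  show ?case
    unfolding evaluates_def by (auto intro!: reaches_next simp: machine_step_def)
next
  case (succ x)
  show ?case
    unfolding evaluates_def by (auto intro!: reaches_next simp: machine_step_def)
next
  case (proj i xs)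
  then show ?case by (rule evaluates_Proj)
next
  case (comp xs gs ys f z)
  have "list_all2 (\<lambda>g y. evaluates g xs y) (rev gs) (rev ys)"
    using comp.IH(1) by (auto simp: list_all2_rev elim: list_all2_mono)
  note args = reaches_arguments[OF this, of "code f" "[]"]
  show ?case
    unfolding evaluates_def
  proof (intro allI)
    fix k r
    show "reaches (pair (push (code (Comp f gs)) (list_code xs) k) r) (pair k z)"
      using reaches_trans[OF args[of k r] evaluatesD] comp.IH(2) by (simp add: rev_map)
  qed
next
  case (primrec_0 g xs y h)
  show ?case
    unfolding evaluates_def
  proof (intro allI)
    fix k r
    show "reaches (pair (push (code (PrimRec g h)) (list_code (0 # xs)) k) r) (pair k y)"
      using evaluatesD[OF primrec_0.IH, of k 0]
      by (intro reaches_step[of "pair (push _ _ _) r"]) (simp add: machine_step_def)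
  qed
next
  case (primrec_Suc g h n xs y z)
  show ?case
    unfolding evaluates_def
  proof (intro allI)
    fix k r
    let ?k = "push (instr 7 (code h) n) (list_code xs) k"
    have "reaches (pair (push (code (PrimRec g h)) (list_code (n # xs)) ?k) 0) (pair ?k y)"
      by (rule evaluatesD[OF primrec_Suc.IH(1)])
    also have "reaches (pair ?k y) (pair k z)"
      using evaluatesD[OF primrec_Suc.IH(2), of k 0]
      by (intro reaches_step[of "pair ?k y"]) (simp add: machine_step_def)
    finally (reaches_trans)
    show "reaches (pair (push (code (PrimRec g h)) (list_code (Suc n # xs)) k) r) (pair k z)"
      by (intro reaches_step[of "pair (push _ _ _) r"]) (simp add: machine_step_def)
  qed
next
  case (mu f n xs)
  show ?case
    unfolding evaluates_def
  proof (intro allI)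
    fix k r
    let ?k = "push (instr 8 (code f) n) (list_code xs) k"
    obtain r' where "reaches (pair (push (code (Mu f)) (list_code xs) k) r)
        (pair (push (instr 5 (code f) n) (list_code xs) k) r')"
      using reaches_search[of n f xs k r] mu.IH(2) by auto
    also have "reaches (pair (push (instr 5 (code f) n) (list_code xs) k) r') (pair ?k 0)"
      using evaluatesD[OF mu.IH(1), of ?k 0]
      by (intro reaches_step[of "pair (push _ _ _) r'"]) (simp add: machine_step_def)
    also (reaches_trans) have "reaches (pair ?k 0) (pair k n)"
      by (rule reaches_next) (simp add: machine_step_def)
    finally (reaches_trans)
    show "reaches (pair (push (code (Mu f)) (list_code xs) k) r) (pair k n)" .
  qed
qed

lemma machine_low_absorbing:
  assumes "(machine ^^ t) s < 4" "t \<le> t'"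
  shows "(machine ^^ t') s < 4"
  using assms(2)
proof (induction t' rule: dec_induct)
  case base
  show ?case by (rule assms(1))
next
  case (step t')
  then show ?case by (simp add: machine_def)
qed

lemma search_diverges:
  assumes "\<And>m. \<exists>y. evaluates f (m # xs) (Suc y)"
  shows "4 \<le> (machine ^^ t) (pair (push (code (Mu f)) (list_code xs) k) r)"
proof -
  let ?s = "\<lambda>m r. pair (push (instr 5 (code f) m) (list_code xs) k) r"
  have late: "\<exists>t' r'. m \<le> t' \<and> (machine ^^ t') (?s 0 r) = ?s m r'" for m
  proof (induction m)
    case 0
    have "(machine ^^ 0) (?s 0 r) = ?s 0 r" by simp
    then show ?case by blast
  next
    case (Suc m)
    then obtain t' r' where t': "m \<le> t'" "(machine ^^ t') (?s 0 r) = ?s m r'"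
      by blast
    obtain y where "evaluates f (m # xs) (Suc y)"
      using assms by blast
    from search_round[OF this] obtain u where u: "u > 0" "(machine ^^ u) (?s m r') = ?s (Suc m) 0"
      by blast
    have "(machine ^^ (u + t')) (?s 0 r) = ?s (Suc m) 0"
      using t'(2) u(2) by (simp add: funpow_add)
    moreover have "Suc m \<le> u + t'"
      using t'(1) u(1) by simp
    ultimately show ?case by blast
  qed
  from late[of t] obtain t' r' where t': "t \<le> t'" "(machine ^^ t') (?s 0 r) = ?s t r'"
    by blast
  then show ?thesis
    using machine_low_absorbing[of t "?s 0 r" t']
      pair_ge_4[of "push (instr 5 (code f) t) (list_code xs) k" r']
    by (force simp: not_less[symmetric])
qed

section \<open>Undecidability of halting\<close>

text \<open>The program coded by \<open>n\<close>, applied to its own code.\<close>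

definition start :: "nat \<Rightarrow> nat" where
  "start n = pair (push n (list_code [n]) 0) 0"

definition rec_add :: recf where
  "rec_add = PrimRec (Proj 0) (Comp Succ [Proj 1])"

definition rec_mult :: recf where
  "rec_mult = PrimRec Zero (Comp rec_add [Proj 1, Proj 2])"

definition rec_pair :: recf where
  "rec_pair =
    (let s = Comp Succ [Comp Succ [rec_add]] in Comp rec_add [Comp rec_mult [s, s], Proj 0])"

definition rec_start :: recf where
  "rec_start = Comp rec_pair [Comp rec_pair [Comp rec_pair [Proj 0, Comp rec_pair [Proj 0, Zero]],
     Zero], Zero]"

lemma rec_eval_Proj: "i < length xs \<Longrightarrow> xs ! i = y \<Longrightarrow> rec_eval (Proj i) xs y"
  using proj by blast

lemma rec_eval_Comp1:
  "rec_eval g xs y \<Longrightarrow> rec_eval f [y] z \<Longrightarrow> rec_eval (Comp f [g]) xs z"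
  by (rule comp[where ys = "[y]"]) auto

lemma rec_eval_Comp2:
  "rec_eval g xs y \<Longrightarrow> rec_eval h xs y' \<Longrightarrow> rec_eval f [y, y'] z \<Longrightarrow>
    rec_eval (Comp f [g, h]) xs z"
  by (rule comp[where ys = "[y, y']"]) auto

lemma rec_eval_add: "rec_eval rec_add [m, n] (m + n)"
proof (induction m)
  case 0
  show ?case
    unfolding rec_add_def by (auto intro!: primrec_0 rec_eval_Proj)
next
  case (Suc m)
  have "rec_eval (Comp Succ [Proj 1]) [m, m + n, n] (Suc (m + n))"
    by (rule rec_eval_Comp1[OF rec_eval_Proj succ]) auto
  then show ?case
    using primrec_Suc[OF Suc[unfolded rec_add_def]] by (simp add: rec_add_def)
qed

lemma rec_eval_mult: "rec_eval rec_mult [m, n] (m * n)"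
proof (induction m)
  case 0
  show ?case
    unfolding rec_mult_def by (auto intro!: primrec_0 zero)
next
  case (Suc m)
  have "rec_eval (Comp rec_add [Proj 1, Proj 2]) [m, m * n, n] (m * n + n)"
    by (rule rec_eval_Comp2[OF rec_eval_Proj rec_eval_Proj rec_eval_add]) auto
  then show ?case
    using primrec_Suc[OF Suc[unfolded rec_mult_def]] by (simp add: rec_mult_def add.commute)
qed

lemma rec_eval_pair: "rec_eval rec_pair [a, b] (pair a b)"
proof -
  let ?s = "Comp Succ [Comp Succ [rec_add]]"
  have "rec_eval ?s [a, b] (Suc (Suc (a + b)))"
    by (intro rec_eval_Comp1[OF _ succ] rec_eval_add)
  then show ?thesis
    unfolding rec_pair_def Let_def pair_def
    by (intro rec_eval_Comp2[OF _ _ rec_eval_add] rec_eval_Comp2[OF _ _ rec_eval_mult]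
        rec_eval_Proj) simp_all
qed

lemma rec_eval_start: "rec_eval rec_start (n # xs) (start n)"
  unfolding rec_start_def start_def push_def list_code_simps
  by (intro rec_eval_Comp2[OF _ _ rec_eval_pair] rec_eval_Proj zero) simp_all

text \<open>
  The program \<open>d\<close> below searches on input \<open>n\<close> for a zero of a function that ignores the
  candidate and returns the verdict of \<open>f\<close> on \<open>start n\<close>.
\<close>

lemma machine_halting_undecidable: "\<not> decidable {s. 4 \<le> s \<and> (\<exists>t. (machine ^^ t) s < 4)}"
  (is "\<not> decidable ?H")
proof
  assume "decidable ?H"
  then obtain f where f: "\<And>n. rec_eval f [n] (if n \<in> ?H then 1 else 0)"
    unfolding decidable_def by blast
  let ?g = "Comp f [Comp rec_start [Proj 1]]"
  define d where "d = Mu ?g"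
  let ?n = "code d"
  have start_n: "start ?n = pair (push (code d) (list_code [?n]) 0) 0"
    by (simp add: start_def)
  have g: "rec_eval ?g [m, ?n] (if start ?n \<in> ?H then 1 else 0)" for m
    by (intro rec_eval_Comp1[OF _ f] rec_eval_Comp1[OF _ rec_eval_start] rec_eval_Proj) simp_all
  show False
  proof (cases "start ?n \<in> ?H")
    case True
    then have "evaluates ?g (m # [?n]) (Suc 0)" for m
      using rec_eval_reaches[OF g[of m]] by simp
    then have "4 \<le> (machine ^^ t) (start ?n)" for t
      unfolding start_n unfolding d_def by (intro search_diverges) blast
    with True show False
      by (auto simp: not_less[symmetric])
  next
    case False
    then have "rec_eval ?g [0, ?n] 0"
      using g[of 0] by (simp only: if_False)
    then have "rec_eval d [?n] 0"
      using mu[of ?g 0 "[?n]"] unfolding d_def by simp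
    then have "reaches (start ?n) (pair 0 0)"
      unfolding start_n by (intro evaluatesD rec_eval_reaches)
    then obtain t where "(machine ^^ t) (start ?n) = pair 0 0"
      unfolding reaches_def by blast
    then have "(machine ^^ Suc t) (start ?n) = 0"
      by (simp add: machine_empty)
    then have "(machine ^^ Suc t) (start ?n) < 4"
      by simp
    moreover have "4 \<le> start ?n"
      unfolding start_n by (rule pair_ge_4)
    ultimately have "start ?n \<in> ?H" by blast
    with False show False ..
  qed
qed

lemma iterate_denote1:
  assumes "\<forall>n\<ge>4. denote1 F (of_nat n) = Some (complex_of_real (real (h n)))"
    and "\<And>i. i < j \<Longrightarrow> 4 \<le> (h ^^ i) s"
  shows "iterate_partial (denote1 F) j (of_nat s) = Some (of_nat ((h ^^ j) s))"
  using assms(2) by (induction j) (auto simp: assms(1))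

text \<open>
  The term computes \<open>h\<close> only from the threshold on, so iterates of the two are compared up to the
  first one below the threshold; the time of that one is the witness for the left-hand side.
\<close>

lemma term_drops_iff:
  assumes F: "\<forall>n\<ge>4. denote1 F (of_nat n) = Some (complex_of_real (real (h n)))"
    and s: "4 \<le> s"
  shows "(\<exists>t\<ge>1.
      (\<forall>j<t. \<exists>x :: real. iterate_partial (denote1 F) j (of_nat s) = Some (complex_of_real x)
        \<and> x \<ge> of_int 4) \<and>
      (\<exists>x :: real. iterate_partial (denote1 F) t (of_nat s) = Some (complex_of_real x)
        \<and> x < of_int 4))
    \<longleftrightarrow> (\<exists>t. (h ^^ t) s < 4)" (is "?drops \<longleftrightarrow> ?halts")
proof
  assume ?drops
  then obtain t and x :: real
    where x: "iterate_partial (denote1 F) t (of_nat s) = Some (complex_of_real x)" "x < 4"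
    by auto
  show ?halts
  proof (rule ccontr)
    assume "\<not> ?halts"
    then have high: "4 \<le> (h ^^ i) s" for i
      by (simp add: not_less)
    then have "complex_of_real x = of_nat ((h ^^ t) s)"
      using iterate_denote1[OF F, of t s] x(1) by simp
    then have "x = real ((h ^^ t) s)"
      by (metis of_real_eq_iff of_real_of_nat_eq)
    with x(2) high[of t] show False by simp
  qed
next
  assume ?halts
  define t where "t = (LEAST t. (h ^^ t) s < 4)"
  have low: "(h ^^ t) s < 4"
    unfolding t_def using \<open>?halts\<close> by (rule LeastI_ex)
  have high: "4 \<le> (h ^^ i) s" if "i < t" for i
    using not_less_Least[OF that[unfolded t_def]] by simp
  have it: "iterate_partial (denote1 F) j (of_nat s) = Some (complex_of_real (real ((h ^^ j) s)))"
    if "j \<le> t" for j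
    using iterate_denote1[OF F, of j s] high that by simp
  have "t \<noteq> 0"
    using low s by (intro notI) simp
  then have "t \<ge> 1" by simp
  moreover have "\<exists>x :: real. iterate_partial (denote1 F) j (of_nat s) = Some (complex_of_real x)
        \<and> x \<ge> of_int 4" if "j < t" for j
    using it[of j] high[OF that] that by (intro exI[of _ "real ((h ^^ j) s)"]) simp
  moreover have "\<exists>x :: real. iterate_partial (denote1 F) t (of_nat s) = Some (complex_of_real x)
        \<and> x < of_int 4"
    using it[of t] low by (intro exI[of _ "real ((h ^^ t) s)"]) simp
  ultimately show ?drops by blast
qed

theorem corollary5p3:
  "\<exists>(F :: unit log_exp_term) (B :: int). constant_free F \<and> B \<ge> 4 \<and>
    \<not> decidable {s :: nat. int s \<ge> B \<and> (\<exists>t\<ge>1.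
      (\<forall>j<t. \<exists>x :: real.
        iterate_partial (denote1 F) j (of_nat s) = Some (complex_of_real x) \<and> x \<ge> of_int B) \<and>
      (\<exists>x :: real.
        iterate_partial (denote1 F) t (of_nat s) = Some (complex_of_real x) \<and> x < of_int B))}"
proof -
  have "real_representable (\<lambda>n. real (machine n))"
    using representable_machine_step unfolding representable_def
    by (rule real_representable_cong) (simp add: machine_def)
  then obtain F where cf: "constant_free F"
    and F: "\<forall>n\<ge>4. denote1 F (of_nat n) = Some (complex_of_real (real (machine n)))"
    unfolding real_representable_def by blast
  have "{s :: nat. int s \<ge> 4 \<and> (\<exists>t\<ge>1.
      (\<forall>j<t. \<exists>x :: real.
        iterate_partial (denote1 F) j (of_nat s) = Some (complex_of_real x) \<and> x \<ge> of_int 4) \<and>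
      (\<exists>x :: real.
        iterate_partial (denote1 F) t (of_nat s) = Some (complex_of_real x) \<and> x < of_int 4))}
    = {s. 4 \<le> s \<and> (\<exists>t. (machine ^^ t) s < 4)}" (is "?S = _")
    by (rule Collect_cong, rule conj_cong) (simp, simp only: term_drops_iff[OF F])
  then have "\<not> decidable ?S"
    using machine_halting_undecidable by (simp only:) simp
  with cf show ?thesis
    by (intro exI[of _ F] exI[of _ 4]) blast
qed

end
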